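(* Let $\mathrm{k}$ be a field of characteristic zero, $\mathcal{A}$ an associative (not necessarily commutative) unital $\mathrm{k}$-algebra, $\mathcal{M}$ a unital $\mathcal{A}$-bimodule, and let $E,H\in\mathcal{A}$ and $c\in\mathrm{k}$ satisfy $[H,E]=HE-EH=cE$. Then for all $k\ge 0$ and all $N\ge 1$, the first $N$ equations of the system $\mathrm{Eq}^k$ are equivalent to the first $N$ equations of the system $\mathrm{Eq}^0$; that is, a polynomial $p\in\mathcal{M}[t]$ satisfies the first $N$ equations of $\mathrm{Eq}^k$ if and only if it satisfies the first $N$ equations of $\mathrm{Eq}^0$. In particular this is true for the system $\mathrm{Eq}^\infty$: for all $N\ge1$, the first $N$ equations of $\mathrm{Eq}^\infty$ are equivalent to the first $N$ equations of $\mathrm{Eq}^0$.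
   Context: $\mathcal{M}[t]=\mathcal{M}\otimes_{\mathrm{k}}\mathrm{k}[t]$. For $p=p_0+p_1t+\dots+p_dt^d\in\mathcal{M}[t]$ and $r\in\mathcal{A}$, evaluation uses the right action: $p(r)=p_0+p_1r+\dots+p_dr^d\in\mathcal{M}$. For $m\in\mathcal{M}$, $\mathrm{ad}_E(m)=Em-mE$, and $\mathrm{ad}_E$ is extended to $\mathcal{M}[t]$ coefficientwise. Define operators on $\mathcal{M}[t]$ by $\partial_1p(t)=p(t)-p(t-1)$ and $\delta_{c-1}p(t)=p(t)-p(t-(c-1))$ (so $\delta_0=0$, and $\delta_{c-1}^0$ is the identity). An expression such as $\mathrm{ad}_E^{a}\partial_1^{k}\delta_{c-1}^{i}\,p(r)$ means: apply the operators to the polynomial $p$, then evaluate the resulting polynomial at $r$. For $k\ge0$ and $n\ge k$, $\mathrm{eq}_n^k$ denotes the following equation in the unknown $p\in\mathcal{M}[t]$: $$\sum_{i=0}^k\sum_{j=0}^{n-k}(-1)^i\binom{k}{i}\binom{n-k}{j}\,\mathrm{ad}_E^{\,n-(j+i)}\partial_1^k\delta_{c-1}^i\,p(H+n-cj-i)\,E^{j+i}=\sum_{i=0}^k(-1)^i\binom{k}{i}\,\mathrm{ad}_E^{\,k-i}\partial_1^k\delta_{c-1}^i\,p(H-n+2k-i)\,E^{n-(k-i)}.$$ For $k\ge0$, $\mathrm{Eq}^k$ is the system consisting, in this order, of the equations $\mathrm{eq}_1^0,\mathrm{eq}_2^1,\dots,\mathrm{eq}_k^{k-1}$ followed by $\mathrm{eq}_{k+1}^k,\mathrm{eq}_{k+2}^k,\dots$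 (i.e. $\{\mathrm{eq}_n^k:n>k\}$). In particular $\mathrm{Eq}^0=\{\mathrm{eq}_n^0:n\ge1\}$, which is the system $E^np(H+n)=p(H-n)E^n$, $n\ge1$. The system $\mathrm{Eq}^\infty$ consists, in order, of the equations $\mathrm{eq}_{n+1}^n$, $n\ge0$. *)

theory Defs
  imports "HOL-Computational_Algebra.Polynomial"
begin

(* The sort {ring, monoid_mult} is that of associative unital rings; ring_1 would
   additionally exclude the zero ring. *)
locale algebra_bimodule =
  alg: vector_space scaleA + bim: vector_space scaleM
  for scaleA :: "'k::field_char_0 \<Rightarrow> 'a::{ring, monoid_mult} \<Rightarrow> 'a"  (infixr "*\<^sub>A" 75)
  and scaleM :: "'k \<Rightarrow> 'm::ab_group_add \<Rightarrow> 'm"  (infixr "*\<^sub>M" 75) +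
  fixes lact :: "'a \<Rightarrow> 'm \<Rightarrow> 'm"  (infixr "\<rhd>" 73)
    and ract :: "'m \<Rightarrow> 'a \<Rightarrow> 'm"  (infixl "\<lhd>" 73)
  assumes scaleA_mult_left: "(s *\<^sub>A a) * b = s *\<^sub>A (a * b)"
    and scaleA_mult_right: "a * (s *\<^sub>A b) = s *\<^sub>A (a * b)"
    and lact_add_left: "(a + b) \<rhd> m = (a \<rhd> m) + (b \<rhd> m)"
    and lact_add_right: "a \<rhd> (m + m') = (a \<rhd> m) + (a \<rhd> m')"
    and lact_scale_left: "(s *\<^sub>A a) \<rhd> m = s *\<^sub>M (a \<rhd> m)"
    and lact_scale_right: "a \<rhd> (s *\<^sub>M m) = s *\<^sub>M (a \<rhd> m)"
    and lact_one: "1 \<rhd> m = m"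
    and lact_mult: "(a * b) \<rhd> m = a \<rhd> (b \<rhd> m)"
    and ract_add_left: "(m + m') \<lhd> a = (m \<lhd> a) + (m' \<lhd> a)"
    and ract_add_right: "m \<lhd> (a + b) = (m \<lhd> a) + (m \<lhd> b)"
    and ract_scale_left: "(s *\<^sub>M m) \<lhd> a = s *\<^sub>M (m \<lhd> a)"
    and ract_scale_right: "m \<lhd> (s *\<^sub>A a) = s *\<^sub>M (m \<lhd> a)"
    and ract_one: "m \<lhd> 1 = m"
    and ract_mult: "m \<lhd> (a * b) = (m \<lhd> a) \<lhd> b"
    and lact_ract: "(a \<rhd> m) \<lhd> b = a \<rhd> (m \<lhd> b)"
begin

(* Elements of M[t] are represented by the type 'm poly. *)

definition eval_right :: "'m poly \<Rightarrow> 'a \<Rightarrow> 'm" where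
  "eval_right p r = (\<Sum>d\<le>degree p. coeff p d \<lhd> r ^ d)"

definition ad :: "'a \<Rightarrow> 'm \<Rightarrow> 'm" where
  "ad E m = (E \<rhd> m) - (m \<lhd> E)"

definition ad_poly :: "'a \<Rightarrow> 'm poly \<Rightarrow> 'm poly" where
  "ad_poly E p = map_poly (ad E) p"

definition tensor :: "'m \<Rightarrow> 'k poly \<Rightarrow> 'm poly" where
  "tensor m q = map_poly (\<lambda>s. s *\<^sub>M m) q"

(* translate a p is p(t - a) *)
definition translate :: "'k \<Rightarrow> 'm poly \<Rightarrow> 'm poly" where
  "translate a p = (\<Sum>d\<le>degree p. tensor (coeff p d) ([:- a, 1:] ^ d))"

definition \<delta> :: "'k \<Rightarrow> 'm poly \<Rightarrow> 'm poly" where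
  "\<delta> a p = p - translate a p"

abbreviation partial1 :: "'m poly \<Rightarrow> 'm poly"  ("\<partial>\<^sub>1") where
  "\<partial>\<^sub>1 \<equiv> \<delta> 1"

(* eqn n k is eq_n^k, meant for k \<le> n; all exponents below are then genuine differences. *)
definition eqn :: "'a \<Rightarrow> 'a \<Rightarrow> 'k \<Rightarrow> nat \<Rightarrow> nat \<Rightarrow> 'm poly \<Rightarrow> bool" where
  "eqn E H c n k p \<longleftrightarrow>
    (\<Sum>i\<le>k. \<Sum>j\<le>n - k.
        ((-1) ^ i * of_nat (k choose i) * of_nat ((n - k) choose j)) *\<^sub>M
          (eval_right ((ad_poly E ^^ (n - (j + i))) ((\<partial>\<^sub>1 ^^ k) ((\<delta> (c - 1) ^^ i) p)))
             (H + (of_nat n - c * of_nat j - of_nat i) *\<^sub>A 1)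
           \<lhd> E ^ (j + i)))
    = (\<Sum>i\<le>k.
        ((-1) ^ i * of_nat (k choose i)) *\<^sub>M
          (eval_right ((ad_poly E ^^ (k - i)) ((\<partial>\<^sub>1 ^^ k) ((\<delta> (c - 1) ^^ i) p)))
             (H + (- of_nat n + 2 * of_nat k - of_nat i) *\<^sub>A 1)
           \<lhd> E ^ (n - (k - i))))"

(* The systems are sequences indexed from 0: Eq E H c k l is the (l+1)-st equation of Eq^k. *)
definition Eq :: "'a \<Rightarrow> 'a \<Rightarrow> 'k \<Rightarrow> nat \<Rightarrow> nat \<Rightarrow> 'm poly \<Rightarrow> bool" where
  "Eq E H c k l p \<longleftrightarrow> (if l < k then eqn E H c (l + 1) l p else eqn E H c (l + 1) k p)"

definition Eq_inf :: "'a \<Rightarrow> 'a \<Rightarrow> 'k \<Rightarrow> nat \<Rightarrow> 'm poly \<Rightarrow> bool" where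
  "Eq_inf E H c l p \<longleftrightarrow> eqn E H c (l + 1) l p"

end

end

theory Submission
  imports Defs
begin

text \<open>
  Let \<open>Z\<^sub>k\<close> arise from the function \<open>s \<mapsto> p(H + s)\<close> by \<open>k\<close> applications of the
  operator sending \<open>Z\<close> to \<open>s \<mapsto> E Y(s) - Y(s - 1) E\<close>, where \<open>Y(s) = Z(s) - Z(s - 1)\<close>.
  Since \<open>E q(H + s) = (ad\<^sub>E q)(H + s) + q(H + s - c) E\<close>, the binomial theorem collapses
  the sums in \<open>eq\<^sub>n\<^sup>k\<close>, and with \<open>m = n - k\<close> the equation becomes
  \<open>D\<^sub>k(m) = 0\<close>, where \<open>D\<^sub>k(m) = E\<^sup>m Z\<^sub>k(k + m) - Z\<^sub>k(k - m) E\<^sup>m\<close>. The recursion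
  \<open>D\<^sub>k\<^sub>+\<^sub>1(m) = D\<^sub>k(m + 1) - E D\<^sub>k(m) - D\<^sub>k(m) E + E D\<^sub>k(m - 1) E\<close> for \<open>m \<ge> 1\<close>,
  together with \<open>D\<^sub>k(0) = 0\<close>, shows that
  \<open>eq\<^sub>n\<^sup>k\<close> and \<open>eq\<^sub>n\<^sup>0\<close> agree modulo the equations \<open>eq\<^sub>j\<^sup>0\<close> with \<open>j < n\<close>.
\<close>

context algebra_bimodule
begin

section \<open>Arithmetic of the bimodule and of the operators on \<open>M[t]\<close>\<close>

lemma lact_additive: "Modules.additive (\<lambda>m. a \<rhd> m)"
  by (simp add: Modules.additive_def lact_add_right)

lemma ract_additive: "Modules.additive (\<lambda>m. m \<lhd> a)" "Modules.additive (\<lambda>a. m \<lhd> a)"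
  by (simp_all add: Modules.additive_def ract_add_left ract_add_right)

lemmas lact_zero_right [simp] = additive.zero [OF lact_additive]
lemmas ract_zero_left [simp] = additive.zero [OF ract_additive(1)]
lemmas lact_diff_right = additive.diff [OF lact_additive]
lemmas ract_diff_left = additive.diff [OF ract_additive(1)]
lemmas lact_sum_right = additive.sum [OF lact_additive]
lemmas ract_sum_left = additive.sum [OF ract_additive(1)]

lemma ract_one_scale: "m \<lhd> (s *\<^sub>A 1) = s *\<^sub>M m"
  by (simp add: ract_scale_right ract_one)

lemma ad_add: "ad E (m + m') = ad E m + ad E m'"
  by (simp add: ad_def lact_add_right ract_add_left)

lemma ad_zero [simp]: "ad E 0 = 0"
  by (simp add: ad_def)

lemma ad_scale: "ad E (s *\<^sub>M m) = s *\<^sub>M ad E m"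
  by (simp add: ad_def lact_scale_right ract_scale_left bim.scale_right_diff_distrib)

lemma coeff_ad_poly [simp]: "coeff (ad_poly E p) d = ad E (coeff p d)"
  by (simp add: ad_poly_def coeff_map_poly)

lemma coeff_tensor [simp]: "coeff (tensor m q) d = coeff q d *\<^sub>M m"
  by (simp add: tensor_def coeff_map_poly)

lemma degree_ad_poly_le: "degree (ad_poly E p) \<le> degree p"
  by (simp add: degree_le coeff_eq_0)

lemma ad_poly_diff: "ad_poly E (p - q) = ad_poly E p - ad_poly E q"
  using additive.diff [of "ad E"] by (auto simp: poly_eq_iff Modules.additive_def ad_add)

lemma ad_poly_sum: "ad_poly E (\<Sum>x\<in>S. f x) = (\<Sum>x\<in>S. ad_poly E (f x))"
  using additive.sum [of "ad E"]
  by (auto simp: poly_eq_iff Modules.additive_def ad_add coeff_sum)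

lemma ad_poly_tensor: "ad_poly E (tensor m q) = tensor (ad E m) q"
  by (simp add: poly_eq_iff ad_scale)

text \<open>\<open>ad_poly E\<close> may lower the degree; a common upper bound lets the sums for
  \<open>p\<close> and \<open>ad_poly E p\<close> run over the same range.\<close>

lemma translate_eq_sum:
  assumes "degree p \<le> n"
  shows "translate a p = (\<Sum>d\<le>n. tensor (coeff p d) ([:- a, 1:] ^ d))"
proof -
  have "tensor (0::'m) q = 0" for q
    by (simp add: poly_eq_iff)
  then show ?thesis
    unfolding translate_def using assms
    by (intro sum.mono_neutral_left) (auto simp: coeff_eq_0)
qed

lemma ad_poly_translate: "ad_poly E (translate a p) = translate a (ad_poly E p)"
  by (simp add: translate_eq_sum [OF degree_ad_poly_le] translate_eq_sum [of p "degree p"]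
      ad_poly_sum ad_poly_tensor)

lemma ad_poly_\<delta>: "ad_poly E (\<delta> a p) = \<delta> a (ad_poly E p)"
  by (simp add: \<delta>_def ad_poly_diff ad_poly_translate)

text \<open>Moves powers of \<open>ad_poly E\<close> innermost, where their exponent can serve as
  the index of a family of functions.\<close>

lemma ad_poly_funpow_\<delta>: "(ad_poly E ^^ x) ((\<delta> a ^^ i) p) = (\<delta> a ^^ i) ((ad_poly E ^^ x) p)"
proof -
  have "ad_poly E ((\<delta> a ^^ i) p) = (\<delta> a ^^ i) (ad_poly E p)" for p
    by (induction i) (simp_all add: ad_poly_\<delta>)
  then show ?thesis
    by (induction x) simp_all
qed

section \<open>Right evaluation: translation and commutation with \<open>E\<close>\<close>

lemma eval_right_eq_sum:
  assumes "degree p \<le> n"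
  shows "eval_right p r = (\<Sum>d\<le>n. coeff p d \<lhd> r ^ d)"
  unfolding eval_right_def using assms
  by (intro sum.mono_neutral_left) (auto simp: coeff_eq_0)

lemma eval_right_add: "eval_right (p + q) r = eval_right p r + eval_right q r"
  using eval_right_eq_sum [of p "max (degree p) (degree q)" r]
    eval_right_eq_sum [of q "max (degree p) (degree q)" r]
    eval_right_eq_sum [OF degree_add_le_max, of p q r]
  by (simp add: ract_add_left sum.distrib)

lemma eval_right_additive: "Modules.additive (\<lambda>p. eval_right p r)"
  by (simp add: Modules.additive_def eval_right_add)

lemma eval_right_pCons: "eval_right (pCons m p) r = m + eval_right p r \<lhd> r"
proof -
  have "eval_right (pCons m p) r = (\<Sum>d\<le>Suc (degree p). coeff (pCons m p) d \<lhd> r ^ d)"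
    by (intro eval_right_eq_sum) (simp add: degree_pCons_le)
  also have "\<dots> = m + (\<Sum>d\<le>degree p. (coeff p d \<lhd> r ^ d) \<lhd> r)"
    by (subst sum.atMost_Suc_shift)
      (simp add: ract_one power_Suc2 ract_mult del: power_Suc sum.atMost_Suc)
  finally show ?thesis
    by (simp add: eval_right_def ract_sum_left)
qed

lemma eval_right_tensor_smult: "eval_right (tensor m (smult s q)) r = s *\<^sub>M eval_right (tensor m q) r"
proof -
  have "degree (tensor m (smult s q)) \<le> degree q" "degree (tensor m q) \<le> degree q"
    by (auto intro!: degree_le simp: coeff_eq_0)
  then show ?thesis
    by (simp add: eval_right_eq_sum bim.scale_sum_right flip: ract_scale_left)
qed

lemma eval_right_tensor_linear_power:
  "eval_right (tensor m ([:- a, 1:] ^ d)) r = m \<lhd> (r - a *\<^sub>A 1) ^ d"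
proof (induction d)
  case 0
  have "tensor m 1 = [:m:]"
    by (auto simp: poly_eq_iff coeff_pCons one_pCons split: nat.splits)
  then show ?case
    by (simp add: eval_right_def ract_one)
next
  case (Suc d)
  let ?q = "[:- a, 1:] ^ d"
  \<comment> \<open>The factor t - a is split into its constant and t. Multiplication by t is
    \<open>pCons 0\<close>, which evaluation turns into right multiplication by
    \<open>r\<close>.\<close>
  have "tensor m ([:- a, 1:] ^ Suc d) = tensor m (smult (- a) ?q) + pCons 0 (tensor m ?q)"
    by (auto simp: poly_eq_iff coeff_pCons bim.scale_left_distrib bim.scale_left_diff_distrib split: nat.splits)
  then have "eval_right (tensor m ([:- a, 1:] ^ Suc d)) r =
      (m \<lhd> (r - a *\<^sub>A 1) ^ d) \<lhd> r - a *\<^sub>M (m \<lhd> (r - a *\<^sub>A 1) ^ d)"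
    by (simp only: eval_right_add eval_right_tensor_smult eval_right_pCons Suc) simp
  then show ?case
    by (simp only: power_Suc2 ract_mult additive.diff [OF ract_additive(2)] ract_one_scale)
qed

lemma eval_right_translate: "eval_right (translate a p) r = eval_right p (r - a *\<^sub>A 1)"
  by (simp add: translate_def additive.sum [OF eval_right_additive]
      eval_right_tensor_linear_power eval_right_def [of p])

text \<open>On a monomial, E m = ad_E(m) + m E produces the first term; in the second, carrying
  \<open>E\<close> through \<open>r ^ d\<close> replaces \<open>r\<close> by
  \<open>r - c\<close>.\<close>

lemma lact_eval_right:
  assumes "E * r = (r - c *\<^sub>A 1) * E"
  shows "E \<rhd> eval_right p r = eval_right (ad_poly E p) r + eval_right p (r - c *\<^sub>A 1) \<lhd> E"
proof -
  have *: "E * r ^ d = (r - c *\<^sub>A 1) ^ d * E" for d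
  proof (induction d)
    case (Suc d)
    have "E * r ^ Suc d = (r - c *\<^sub>A 1) * (E * r ^ d)"
      by (metis assms mult.assoc power_Suc)
    then show ?case
      by (simp only: Suc power_Suc mult.assoc)
  qed simp
  have "E \<rhd> (m \<lhd> r ^ d) = ad E m \<lhd> r ^ d + (m \<lhd> (r - c *\<^sub>A 1) ^ d) \<lhd> E" for m d
    by (simp add: ad_def ract_diff_left lact_ract flip: ract_mult * )
  then show ?thesis
    by (simp add: eval_right_def [of p] eval_right_eq_sum [OF degree_ad_poly_le]
        lact_sum_right ract_sum_left sum.distrib)
qed

text \<open>The binomial theorem for two commuting index shifts: each step raises \<open>a\<close>,
  or raises \<open>b\<close> with weight \<sigma>. It serves below with \<sigma> = 1 and \<sigma> =
  -1.\<close>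

lemma binomial_recurrence_solution:
  assumes step: "\<And>n a b. g (Suc n) a b = g n (Suc a) b + \<sigma> *\<^sub>M g n a (Suc b)"
  shows "g n a b = (\<Sum>i\<le>n. (\<sigma> ^ i * of_nat (n choose i)) *\<^sub>M g 0 (a + n - i) (b + i))"
proof (induction n arbitrary: a b)
  case (Suc n)
  define t where "t i = g 0 (a + Suc n - i) (b + i)" for i
  have "g n (Suc a) b = (\<Sum>i\<le>n. (\<sigma> ^ i * of_nat (n choose i)) *\<^sub>M t i)"
    by (simp add: Suc t_def)
  \<comment> \<open>The added term vanishes as \<open>n choose Suc n = 0\<close>. Splitting off
    \<open>i = 0\<close> then aligns this sum with the second one for Pascal's rule.\<close>
  also have "\<dots> = (\<Sum>i\<le>Suc n. (\<sigma> ^ i * of_nat (n choose i)) *\<^sub>M t i)"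
    by simp
  also have "\<dots> = t 0 + (\<Sum>i\<le>n. (\<sigma> ^ Suc i * of_nat (n choose Suc i)) *\<^sub>M t (Suc i))"
    by (subst sum.atMost_Suc_shift) simp
  finally have 1: "g n (Suc a) b = \<dots>" .
  have 2: "\<sigma> *\<^sub>M g n a (Suc b) = (\<Sum>i\<le>n. (\<sigma> ^ Suc i * of_nat (n choose i)) *\<^sub>M t (Suc i))"
    by (simp add: Suc t_def bim.scale_sum_right mult.assoc)
  have "(\<Sum>i\<le>Suc n. (\<sigma> ^ i * of_nat (Suc n choose i)) *\<^sub>M t i) = g n (Suc a) b + \<sigma> *\<^sub>M g n a (Suc b)"
    unfolding 1 2 by (subst sum.atMost_Suc_shift)
      (simp add: bim.scale_left_distrib distrib_left sum.distrib del: sum.atMost_Suc)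
  then show ?case
    by (simp add: step t_def del: sum.atMost_Suc)
qed (simp add: bim.scale_one)

section \<open>Difference operators on functions of a scalar, and intertwined families\<close>

definition bdiff :: "'k \<Rightarrow> ('k \<Rightarrow> 'm) \<Rightarrow> 'k \<Rightarrow> 'm" where
  "bdiff a g s = g s - g (s - a)"

definition twist :: "'a \<Rightarrow> ('k \<Rightarrow> 'm) \<Rightarrow> 'k \<Rightarrow> 'm" where
  "twist E g s = (E \<rhd> g s) - (g (s - 1) \<lhd> E)"

lemma twist_bdiff: "twist E (bdiff a g) = bdiff a (twist E g)"
  by (auto simp: twist_def bdiff_def fun_eq_iff lact_diff_right ract_diff_left algebra_simps)

lemma twist_funpow_bdiff: "twist E ((bdiff a ^^ k) g) = (bdiff a ^^ k) (twist E g)"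
  by (induction k) (simp_all add: twist_bdiff)

lemma twist_bdiff_funpow: "((\<lambda>g. twist E (bdiff a g)) ^^ k) g = (twist E ^^ k) ((bdiff a ^^ k) g)"
proof (induction k)
  case (Suc k)
  have *: "(twist E ^^ k) (bdiff a h) = bdiff a ((twist E ^^ k) h)" for h
    by (induction k) (simp_all add: twist_bdiff)
  show ?case
    by (simp add: Suc *)
qed simp

lemma eval_right_funpow_\<delta>:
  "(\<lambda>s. eval_right ((\<delta> a ^^ i) p) (H + s *\<^sub>A 1)) = (bdiff a ^^ i) (\<lambda>s. eval_right p (H + s *\<^sub>A 1))"
proof (induction i)
  case (Suc i)
  show ?case
  proof
    fix s
    have "eval_right ((\<delta> a ^^ Suc i) p) (H + s *\<^sub>A 1) =
        eval_right ((\<delta> a ^^ i) p) (H + s *\<^sub>A 1) - eval_right ((\<delta> a ^^ i) p) (H + (s - a) *\<^sub>A 1)"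
      by (simp add: \<delta>_def [of a "(\<delta> a ^^ i) p"] additive.diff [OF eval_right_additive]
          eval_right_translate alg.scale_left_diff_distrib add_diff_eq)
    then show "eval_right ((\<delta> a ^^ Suc i) p) (H + s *\<^sub>A 1) =
        (bdiff a ^^ Suc i) (\<lambda>s. eval_right p (H + s *\<^sub>A 1)) s"
      by (simp add: bdiff_def [of a "\<lambda>s. eval_right q (H + s *\<^sub>A 1)" for q] flip: Suc)
  qed
qed simp

text \<open>Abstracts the family s \<mapsto> (ad_E^x p)(H + s), keeping only the rule for moving
  \<open>E\<close> from left to right. Unlike evaluation of polynomials, this rule can be checked to
  survive \<open>twist\<close>.\<close>

definition intertwined :: "'a \<Rightarrow> 'k \<Rightarrow> (nat \<Rightarrow> 'k \<Rightarrow> 'm) \<Rightarrow> bool" where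
  "intertwined E c F \<longleftrightarrow> (\<forall>x s. E \<rhd> F x s = F (Suc x) s + F x (s - c) \<lhd> E)"

lemma intertwined_bdiff: "intertwined E c F \<Longrightarrow> intertwined E c (\<lambda>x. bdiff a (F x))"
  by (auto simp: intertwined_def bdiff_def lact_diff_right ract_diff_left algebra_simps)

lemma intertwined_twist: "intertwined E c F \<Longrightarrow> intertwined E c (\<lambda>x. twist E (F x))"
  by (auto simp: intertwined_def twist_def lact_diff_right ract_diff_left lact_add_right
      ract_add_left lact_ract algebra_simps simp flip: lact_ract)

lemma intertwined_funpow_bdiff: "intertwined E c F \<Longrightarrow> intertwined E c (\<lambda>x. (bdiff a ^^ k) (F x))"
  by (induction k) (simp_all add: intertwined_bdiff)

lemma intertwined_funpow_twist: "intertwined E c F \<Longrightarrow> intertwined E c (\<lambda>x. (twist E ^^ k) (F x))"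
  by (induction k) (simp_all add: intertwined_twist)

text \<open>Each of the \<open>m\<close> factors \<open>E\<close> is either absorbed, raising the
  index of \<open>F\<close>, or crosses to the right, shifting the argument by
  \<open>c\<close>.\<close>

lemma lact_power_expansion:
  assumes "intertwined E c F"
  shows "E ^ m \<rhd> F 0 s = (\<Sum>j\<le>m. of_nat (m choose j) *\<^sub>M (F (m - j) (s - c * of_nat j) \<lhd> E ^ j))"
proof -
  define g where "g n a b = E ^ n \<rhd> (F a (s - c * of_nat b) \<lhd> E ^ b)" for n a b
  have "g (Suc n) a b = g n (Suc a) b + 1 *\<^sub>M g n a (Suc b)" for n a b
    using assms
    by (simp add: g_def intertwined_def power_Suc2 [of E n] lact_mult ract_mult lact_add_right
        ract_add_left algebra_simps bim.scale_one flip: lact_ract del: power_Suc)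
      (simp add: ract_mult)
  from binomial_recurrence_solution [where g = g and \<sigma> = 1, OF this, of m 0 0] show ?thesis
    by (simp add: g_def lact_one ract_one)
qed

text \<open>Here the difference with step \<open>c - 1\<close> arises: crossing leaves G(s - c) E,
  \<open>twist\<close> subtracts G(s - 1) E, and together these are minus
  \<open>bdiff (c - 1) G (s - 1)\<close> times \<open>E\<close>. Iteration is again binomial, with
  sign -1.\<close>

lemma twist_power_expansion:
  assumes "intertwined E c F"
  shows "(twist E ^^ k) (F x) s = (\<Sum>i\<le>k. ((-1) ^ i * of_nat (k choose i)) *\<^sub>M
    ((bdiff (c - 1) ^^ i) (F (x + k - i)) (s - of_nat i) \<lhd> E ^ i))"
proof -
  define g where
    "g n a b = (bdiff (c - 1) ^^ b) ((twist E ^^ n) (F a)) (s - of_nat b) \<lhd> E ^ b" for n a b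
  have step: "twist E G t = G' t - bdiff (c - 1) G (t - 1) \<lhd> E"
    if "\<And>t. E \<rhd> G t = G' t + G (t - c) \<lhd> E" for G G' t
    using that [of t] by (simp add: twist_def bdiff_def ract_diff_left algebra_simps)
  have "g (Suc n) a b = g n (Suc a) b + (-1) *\<^sub>M g n a (Suc b)" for n a b
  proof -
    let ?F = "\<lambda>x. (bdiff (c - 1) ^^ b) ((twist E ^^ n) (F x))"
    have "intertwined E c ?F"
      by (intro intertwined_funpow_bdiff intertwined_funpow_twist assms)
    then have "twist E (?F a) t = ?F (Suc a) t - bdiff (c - 1) (?F a) (t - 1) \<lhd> E" for t
      by (intro step) (simp add: intertwined_def)
    then show ?thesis
      by (simp add: g_def bim.scale_minus_left bim.scale_one ract_diff_left ract_mult diff_diff_eq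
          add.commute [of 1] flip: twist_funpow_bdiff)
  qed
  from binomial_recurrence_solution [where g = g and \<sigma> = "-1", OF this, of k x 0] show ?thesis
    by (simp add: g_def ract_one)
qed

section \<open>The closed form of \<open>eqn\<close>\<close>

lemma intertwined_eval_right:
  assumes "H * E - E * H = c *\<^sub>A E"
  shows "intertwined E c (\<lambda>x s. eval_right ((ad_poly E ^^ x) p) (H + s *\<^sub>A 1))"
proof -
  have "E * (H + s *\<^sub>A 1) = (H + s *\<^sub>A 1 - c *\<^sub>A 1) * E" for s
    using assms by (simp add: algebra_simps scaleA_mult_left scaleA_mult_right)
  from lact_eval_right [OF this] show ?thesis
    by (simp add: intertwined_def alg.scale_left_diff_distrib add_diff_eq)
qed

text \<open>The right side of \<open>eqn\<close> is the expansion of the \<open>k\<close>-fold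
  \<open>twist\<close>, multiplied by \<open>E ^ (n - k)\<close>; the left side comes from expanding
  first \<open>E ^ (n - k)\<close> and then \<open>twist\<close>.\<close>

lemma eqn_iff:
  fixes p :: "'m poly"
  assumes "H * E - E * H = c *\<^sub>A E" and "k \<le> n"
  defines "Z \<equiv> ((\<lambda>g. twist E (bdiff 1 g)) ^^ k) (\<lambda>s. eval_right p (H + s *\<^sub>A 1))"
  shows "eqn E H c n k p \<longleftrightarrow>
    E ^ (n - k) \<rhd> Z (of_nat n) = Z (2 * of_nat k - of_nat n) \<lhd> E ^ (n - k)"
proof -
  define F where
    "F x = (bdiff 1 ^^ k) (\<lambda>s. eval_right ((ad_poly E ^^ x) p) (H + s *\<^sub>A 1))" for x
  have F: "intertwined E c F"
    unfolding F_def by (intro intertwined_funpow_bdiff intertwined_eval_right assms)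
  have Z: "Z = (twist E ^^ k) (F 0)"
    by (simp add: Z_def F_def twist_bdiff_funpow)
  \<comment> \<open>In \<open>eqn\<close> the unit differences are applied last, whereas the
    expansion of \<open>twist\<close> applies those of step \<open>c - 1\<close> last.\<close>
  have comm: "(bdiff 1 ^^ k) ((bdiff (c - 1) ^^ i) g) = (bdiff (c - 1) ^^ i) ((bdiff 1 ^^ k) g)" for i g
  proof -
    have 1: "bdiff 1 (bdiff (c - 1) g) = bdiff (c - 1) (bdiff 1 g)" for g
      by (simp add: bdiff_def fun_eq_iff algebra_simps)
    have "bdiff 1 ((bdiff (c - 1) ^^ i) g) = (bdiff (c - 1) ^^ i) (bdiff 1 g)" for g
      by (induction i) (simp_all add: 1)
    then show ?thesis
      by (induction k) simp_all
  qed
  have ev: "eval_right ((ad_poly E ^^ x) ((\<partial>\<^sub>1 ^^ k) ((\<delta> (c - 1) ^^ i) p))) (H + s *\<^sub>A 1) =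
      (bdiff (c - 1) ^^ i) (F x) s" for x i s
    using fun_cong [OF eval_right_funpow_\<delta>]
    by (simp add: ad_poly_funpow_\<delta> eval_right_funpow_\<delta> F_def comm [symmetric])
  have "E ^ (n - k) \<rhd> Z (of_nat n) = (\<Sum>j\<le>n - k. of_nat ((n - k) choose j) *\<^sub>M
      ((twist E ^^ k) (F (n - k - j)) (of_nat n - c * of_nat j) \<lhd> E ^ j))"
    unfolding Z by (rule lact_power_expansion [OF intertwined_funpow_twist [OF F]])
  also have "\<dots> = (\<Sum>j\<le>n - k. \<Sum>i\<le>k.
      ((-1) ^ i * of_nat (k choose i) * of_nat ((n - k) choose j)) *\<^sub>M
      ((bdiff (c - 1) ^^ i) (F (n - (j + i))) (of_nat n - c * of_nat j - of_nat i) \<lhd> E ^ (j + i)))"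
  proof (intro sum.cong refl)
    fix j assume "j \<in> {..n - k}"
    \<comment> \<open>Subtraction on naturals is truncated; the bounds on \<open>j\<close> and
      \<open>k\<close> make the cancellation of \<open>k\<close> legitimate.\<close>
    then have "n - k - j + k - i = n - (j + i)" for i
      using \<open>k \<le> n\<close> by auto
    then show "of_nat ((n - k) choose j) *\<^sub>M
        ((twist E ^^ k) (F (n - k - j)) (of_nat n - c * of_nat j) \<lhd> E ^ j) = (\<Sum>i\<le>k.
      ((-1) ^ i * of_nat (k choose i) * of_nat ((n - k) choose j)) *\<^sub>M
      ((bdiff (c - 1) ^^ i) (F (n - (j + i))) (of_nat n - c * of_nat j - of_nat i) \<lhd> E ^ (j + i)))"
      by (simp add: twist_power_expansion [OF F] bim.scale_sum_right ract_sum_left ract_scale_left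
          add.commute [of j] power_add ract_mult mult_ac)
  qed
  also have "\<dots> = (\<Sum>i\<le>k. \<Sum>j\<le>n - k.
      ((-1) ^ i * of_nat (k choose i) * of_nat ((n - k) choose j)) *\<^sub>M
      ((bdiff (c - 1) ^^ i) (F (n - (j + i))) (of_nat n - c * of_nat j - of_nat i) \<lhd> E ^ (j + i)))"
    by (rule sum.swap)
  finally have L: "E ^ (n - k) \<rhd> Z (of_nat n) = \<dots>" .
  have "Z (2 * of_nat k - of_nat n) \<lhd> E ^ (n - k) = (\<Sum>i\<le>k.
      ((-1) ^ i * of_nat (k choose i)) *\<^sub>M
      ((bdiff (c - 1) ^^ i) (F (k - i)) (- of_nat n + 2 * of_nat k - of_nat i) \<lhd> E ^ (n - (k - i))))"
    unfolding Z twist_power_expansion [OF F] ract_sum_left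
  proof (intro sum.cong refl)
    fix i assume "i \<in> {..k}"
    then have "E ^ (n - (k - i)) = E ^ i * E ^ (n - k)"
      using \<open>k \<le> n\<close> by (simp add: add.commute flip: power_add)
    then show "((-1) ^ i * of_nat (k choose i)) *\<^sub>M
        ((bdiff (c - 1) ^^ i) (F (0 + k - i)) (2 * of_nat k - of_nat n - of_nat i) \<lhd> E ^ i) \<lhd> E ^ (n - k) =
        ((-1) ^ i * of_nat (k choose i)) *\<^sub>M
        ((bdiff (c - 1) ^^ i) (F (k - i)) (- of_nat n + 2 * of_nat k - of_nat i) \<lhd> E ^ (n - (k - i)))"
      by (simp add: ract_scale_left ract_mult)
  qed
  with L show ?thesis
    by (simp add: eqn_def ev)
qed

section \<open>Recursion for the defects of the equations\<close>

definition defect :: "'a \<Rightarrow> ('k \<Rightarrow> 'm) \<Rightarrow> nat \<Rightarrow> nat \<Rightarrow> 'm" where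
  "defect E Z k m = (E ^ m \<rhd> Z (of_nat k + of_nat m)) - (Z (of_nat k - of_nat m) \<lhd> E ^ m)"

lemma defect_zero [simp]: "defect E Z k 0 = 0"
  by (simp add: defect_def lact_one ract_one)

text \<open>\<open>twist E (bdiff 1 Z)\<close> has four terms, with \<open>Z\<close> at s, s - 1
  (twice) and s - 2. Pairing those at the upper point with those at the lower point in reverse order
  gives the four defects.\<close>

lemma defect_twist:
  "defect E (twist E (bdiff 1 Z)) (Suc k) (Suc m) =
    defect E Z k (Suc (Suc m)) - (E \<rhd> defect E Z k (Suc m)) - (defect E Z k (Suc m) \<lhd> E)
      + (E \<rhd> (defect E Z k m \<lhd> E))"
proof -
  \<comment> \<open>\<open>P\<close> counts upwards from k + m and \<open>Q\<close> downwards from k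
    - m, so that only the offsets 0, 1, 2 occur.\<close>
  define P where "P i = Z (of_nat k + of_nat m + of_nat i)" for i
  define Q where "Q i = Z (of_nat k - of_nat m - of_nat i)" for i
  have tw: "twist E (bdiff 1 Z) s = (E \<rhd> Z s) - (E \<rhd> Z (s - 1)) - (Z (s - 1) \<lhd> E) + (Z (s - 2) \<lhd> E)" for s
    by (simp add: twist_def bdiff_def lact_diff_right ract_diff_left algebra_simps)
  have twisted: "twist E (bdiff 1 Z) (of_nat (Suc k) + of_nat (Suc m)) =
      (E \<rhd> P 2) - (E \<rhd> P 1) - (P 1 \<lhd> E) + (P 0 \<lhd> E)"
    "twist E (bdiff 1 Z) (of_nat (Suc k) - of_nat (Suc m)) =
      (E \<rhd> Q 0) - (E \<rhd> Q 1) - (Q 1 \<lhd> E) + (Q 2 \<lhd> E)"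
    by (simp_all add: tw P_def Q_def algebra_simps)
  have shifts: "Z (of_nat k + of_nat (Suc (Suc m))) = P 2" "Z (of_nat k + of_nat (Suc m)) = P 1"
    "Z (of_nat k + of_nat m) = P 0" "Z (of_nat k - of_nat (Suc (Suc m))) = Q 2"
    "Z (of_nat k - of_nat (Suc m)) = Q 1" "Z (of_nat k - of_nat m) = Q 0"
    by (simp_all add: P_def Q_def algebra_simps)
  have powers: "E ^ i \<rhd> E \<rhd> x = E ^ Suc i \<rhd> x" "E \<rhd> E ^ i \<rhd> x = E ^ Suc i \<rhd> x"
    "(x \<lhd> E) \<lhd> E ^ i = x \<lhd> E ^ Suc i" "(x \<lhd> E ^ i) \<lhd> E = x \<lhd> E ^ Suc i" for i x
    by (simp_all only: power_Suc2 [of E i] flip: lact_mult ract_mult)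
      (simp_all flip: power_Suc2)
  show ?thesis
    unfolding defect_def twisted shifts
    by (simp only: lact_diff_right ract_diff_left lact_add_right ract_add_left lact_ract powers)
      (simp only: algebra_simps)
qed

text \<open>Once the lower defects vanish, only the leading term of the recursion survives, so a
  step in \<open>k\<close> is traded for a step in \<open>m\<close>.\<close>

lemma defect_funpow_twist_bdiff:
  assumes "0 < m" and "\<And>j. j < k + m \<Longrightarrow> defect E g 0 j = 0"
  shows "defect E (((\<lambda>g. twist E (bdiff 1 g)) ^^ k) g) k m = defect E g 0 (k + m)"
  using assms
proof (induction k arbitrary: m)
  case (Suc k)
  let ?D = "defect E (((\<lambda>g. twist E (bdiff 1 g)) ^^ k) g) k"
  obtain m' where m: "m = Suc m'"
    using Suc.prems(1) gr0_conv_Suc by blast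
  have "?D (Suc m) = defect E g 0 (Suc k + m)"
    using Suc.IH [of "Suc m"] Suc.prems by simp
  moreover have "?D m = 0"
    using Suc.IH [of m] Suc.prems by simp
  \<comment> \<open>The induction hypothesis needs a positive argument; at 0 the defect vanishes
    identically.\<close>
  moreover have "?D m' = 0"
    using Suc.IH [of m'] Suc.prems by (cases "m' = 0") (simp_all add: m)
  ultimately show ?case
    by (simp add: m defect_twist)
qed simp

lemma eqn_iff_eqn_0:
  assumes E: "H * E - E * H = c *\<^sub>A E" and "k \<le> l" and "\<And>j. j < l \<Longrightarrow> eqn E H c (Suc j) 0 p"
  shows "eqn E H c (Suc l) k p \<longleftrightarrow> eqn E H c (Suc l) 0 p"
proof -
  let ?g = "\<lambda>s. eval_right p (H + s *\<^sub>A 1)"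
  \<comment> \<open>With n = k + m, the points n and 2k - n of \<open>eqn_iff\<close> are k + m and
    k - m.\<close>
  have eqn_defect: "eqn E H c (k + m) k p \<longleftrightarrow>
      defect E (((\<lambda>g. twist E (bdiff 1 g)) ^^ k) ?g) k m = 0" for k m
    by (simp add: eqn_iff [OF E] defect_def)
  \<comment> \<open>The assumed equations cover 1 to \<open>l\<close>; the case 0 is
    automatic.\<close>
  have "defect E ?g 0 j = 0" if "j < Suc l" for j
    using that assms(3) [of "j - 1"] eqn_defect [of 0 j] by (cases j) simp_all
  then show ?thesis
    using defect_funpow_twist_bdiff [of "Suc l - k" k E ?g] \<open>k \<le> l\<close>
      eqn_defect [of k "Suc l - k"] eqn_defect [of 0 "Suc l"] by simp
qed

text \<open>A free choice of superscripts treats all systems at once. In the induction on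
  \<open>N\<close>, the equivalence so far supplies the lower equations required by
  \<open>eqn_iff_eqn_0\<close>.\<close>

lemma eqn_systems_equivalent:
  assumes "H * E - E * H = c *\<^sub>A E" and "\<And>l. \<kappa> l \<le> l"
  shows "(\<forall>l<N. eqn E H c (Suc l) (\<kappa> l) p) \<longleftrightarrow> (\<forall>l<N. eqn E H c (Suc l) 0 p)"
proof (induction N)
  case (Suc N)
  then show ?case
    using eqn_iff_eqn_0 [OF assms(1), of "\<kappa> N" N p] assms(2) by (auto simp: less_Suc_eq)
qed simp

end

theorem theorem2p2:
  fixes scaleA :: "'k::field_char_0 \<Rightarrow> 'a::{ring, monoid_mult} \<Rightarrow> 'a"
    and scaleM :: "'k \<Rightarrow> 'm::ab_group_add \<Rightarrow> 'm"
    and lact :: "'a \<Rightarrow> 'm \<Rightarrow> 'm"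
    and ract :: "'m \<Rightarrow> 'a \<Rightarrow> 'm"
    and E H :: 'a and c :: 'k
  assumes "algebra_bimodule scaleA scaleM lact ract"
    and "H * E - E * H = scaleA c E"
  shows "(\<forall>k. \<forall>N\<ge>1. \<forall>p :: 'm poly.
            (\<forall>l<N. algebra_bimodule.Eq scaleA scaleM lact ract E H c k l p) \<longleftrightarrow>
            (\<forall>l<N. algebra_bimodule.Eq scaleA scaleM lact ract E H c 0 l p))
       \<and> (\<forall>N\<ge>1. \<forall>p :: 'm poly.
            (\<forall>l<N. algebra_bimodule.Eq_inf scaleA scaleM lact ract E H c l p) \<longleftrightarrow>
            (\<forall>l<N. algebra_bimodule.Eq scaleA scaleM lact ract E H c 0 l p))"
proof -
  interpret algebra_bimodule scaleA scaleM lact ract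
    by fact
  \<comment> \<open>The superscript in \<open>Eq\<close> grows with \<open>l\<close> until it
    reaches \<open>k\<close> and then stays there; in \<open>Eq_inf\<close> it never stops
    growing.\<close>
  have Eq: "Eq E H c k l p \<longleftrightarrow> eqn E H c (Suc l) (min l k) p" for k l p
    by (simp add: Eq_def min_def)
  show ?thesis
    using eqn_systems_equivalent [OF assms(2), where \<kappa> = "\<lambda>l. min l _"]
      eqn_systems_equivalent [OF assms(2), where \<kappa> = "\<lambda>l. l"]
    by (simp add: Eq Eq_inf_def)
qed

end
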